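(* Let $\phi(z_1,\dots,z_n)$ and $\psi(z_1,\dots,z_n)$ be terms in the language $\{\,\cdot\,,0,1,\wedge,\vee,{}^{-1}\}$ with free variables $z_1,\dots,z_n$. Suppose that for every set $X$ the pseudogroup $\mathcal{I}(X)$ satisfies \[\forall f_1,\dots,f_n\in\mathcal{I}(X).\ \phi(f_1,\dots,f_n)\leqslant\psi(f_1,\dots,f_n).\] Then every distributive inverse semigroup $A$ satisfies \[\forall a_1,\dots,a_n\in A.\ \phi(a_1,\dots,a_n)\leqslant\psi(a_1,\dots,a_n).\]
   Context: The ultrafilter lemma (a consequence of the axiom of choice) is assumed. An inverse semigroup is a set $A$ with an associative binary operation $(a,b)\mapsto ab$ such that every $a\in A$ has a unique $a^{-1}\in A$ with $aa^{-1}a=a$ and $a^{-1}aa^{-1}=a^{-1}$. The natural order on $A$ is: $a\leqslant b$ iff $a=be$ for some idempotent $e\in A$. A pair $a,b\in A$ is compatible if both $ab^{-1}$ and $a^{-1}b$ are idempotent. A distributive inverse semigroup is an inverse semigroup $A$ such that: (i) $A$ has a zero element $0$ (with $0a=a0=0$ for all $a$) and a unit $1$; (ii) $A$ has all binary meets $a\wedge b$ with respect to the natural order; (iii) each compatible pair $a,b\in A$ has a join $a\vee b$ in the natural order, and multiplication distributes over these joins on the left and on the right. For a set $X$, $\mathcal{I}(X)$ is the inverse semigroup of partial bijections of $X$ (bijections between subsets of $X$) with multiplication $fg=f\circ g$ (composition as relations); it is a distributive inverse semigroup (indeed a pseudogroup), with natural order given by inclusion of graphs, meets by intersection of graphs,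 joins of compatible pairs by union of graphs, zero the empty partial bijection and unit $\mathrm{id}_X$. The symbols of the language are interpreted as multiplication, zero, unit, binary meet, binary join of compatible pairs, and inverse. Since $\vee$ is a partial operation (defined exactly on compatible pairs), a term may be undefined at some tuples; an inequality $\phi\leqslant\psi$ is understood to be asserted at those tuples at which both terms are defined. *)

theory Defs
  imports "HOL-Algebra.Group" "HOL-Algebra.Lattice"
begin

section \<open>Inverse semigroups\<close>

text \<open>Semigroups are presented by the \<open>monoid\<close> record; the locale \<open>inverse_semigroup\<close> says nothing
  about its field \<open>one\<close>. All other structure (inverse, natural order, meets, joins, zero) is
  determined by carrier and multiplication and is defined from them.\<close>

locale inverse_semigroup =
  fixes G (structure)
  assumes mult_closed: "\<lbrakk>a \<in> carrier G; b \<in> carrier G\<rbrakk> \<Longrightarrow> a \<otimes> b \<in> carrier G"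
    and mult_assoc: "\<lbrakk>a \<in> carrier G; b \<in> carrier G; c \<in> carrier G\<rbrakk>
          \<Longrightarrow> (a \<otimes> b) \<otimes> c = a \<otimes> (b \<otimes> c)"
    and unique_inverse: "a \<in> carrier G
          \<Longrightarrow> \<exists>!b. b \<in> carrier G \<and> a \<otimes> b \<otimes> a = a \<and> b \<otimes> a \<otimes> b = b"

definition sg_inv :: "('a, 'm) monoid_scheme \<Rightarrow> 'a \<Rightarrow> 'a" where
  "sg_inv G a = (THE b. b \<in> carrier G \<and> a \<otimes>\<^bsub>G\<^esub> b \<otimes>\<^bsub>G\<^esub> a = a \<and> b \<otimes>\<^bsub>G\<^esub> a \<otimes>\<^bsub>G\<^esub> b = b)"

definition idems :: "('a, 'm) monoid_scheme \<Rightarrow> 'a set" where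
  "idems G = {e \<in> carrier G. e \<otimes>\<^bsub>G\<^esub> e = e}"

definition nat_order :: "('a, 'm) monoid_scheme \<Rightarrow> 'a gorder" where
  "nat_order G = \<lparr>carrier = carrier G, eq = (=), le = (\<lambda>a b. \<exists>e\<in>idems G. a = b \<otimes>\<^bsub>G\<^esub> e)\<rparr>"

definition compatible :: "('a, 'm) monoid_scheme \<Rightarrow> 'a \<Rightarrow> 'a \<Rightarrow> bool" where
  "compatible G a b \<longleftrightarrow> a \<otimes>\<^bsub>G\<^esub> sg_inv G b \<in> idems G \<and> sg_inv G a \<otimes>\<^bsub>G\<^esub> b \<in> idems G"

definition is_zero :: "('a, 'm) monoid_scheme \<Rightarrow> 'a \<Rightarrow> bool" where
  "is_zero G z \<longleftrightarrow> z \<in> carrier G \<and> (\<forall>a\<in>carrier G. z \<otimes>\<^bsub>G\<^esub> a = z \<and> a \<otimes>\<^bsub>G\<^esub> z = z)"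

definition sg_zero :: "('a, 'm) monoid_scheme \<Rightarrow> 'a" where
  "sg_zero G = (THE z. is_zero G z)"

text \<open>\<open>meet (nat_order G) a b\<close> and \<open>join (nat_order G) a b\<close> are the library's choice of a greatest lower
  and least upper bound; they are meaningful only when such bounds exist. By \<open>join_exists\<close> both sides of
  the distributive laws are such joins: compatibility of \<open>a\<close>, \<open>b\<close> passes to \<open>c \<otimes> a\<close>, \<open>c \<otimes> b\<close>
  and to \<open>a \<otimes> c\<close>, \<open>b \<otimes> c\<close>.\<close>

locale distributive_inverse_semigroup = inverse_semigroup G + monoid G for G (structure) +
  assumes zero_exists: "\<exists>z. is_zero G z"
    and meet_exists: "\<lbrakk>a \<in> carrier G; b \<in> carrier G\<rbrakk>
          \<Longrightarrow> \<exists>m. greatest (nat_order G) m (Lower (nat_order G) {a, b})"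
    and join_exists: "\<lbrakk>a \<in> carrier G; b \<in> carrier G; compatible G a b\<rbrakk>
          \<Longrightarrow> \<exists>j. least (nat_order G) j (Upper (nat_order G) {a, b})"
    and distrib_left: "\<lbrakk>a \<in> carrier G; b \<in> carrier G; c \<in> carrier G; compatible G a b\<rbrakk>
          \<Longrightarrow> c \<otimes> (a \<squnion>\<^bsub>nat_order G\<^esub> b) = (c \<otimes> a) \<squnion>\<^bsub>nat_order G\<^esub> (c \<otimes> b)"
    and distrib_right: "\<lbrakk>a \<in> carrier G; b \<in> carrier G; c \<in> carrier G; compatible G a b\<rbrakk>
          \<Longrightarrow> (a \<squnion>\<^bsub>nat_order G\<^esub> b) \<otimes> c = (a \<otimes> c) \<squnion>\<^bsub>nat_order G\<^esub> (b \<otimes> c)"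

section \<open>Terms and inequalities\<close>

datatype dis_term =
    Var (var_index: nat)
  | Zero
  | One
  | Mult dis_term dis_term
  | Meet dis_term dis_term
  | Join dis_term dis_term
  | Inv dis_term

primrec vars :: "dis_term \<Rightarrow> nat set" where
  "vars (Var i) = {i}"
| "vars Zero = {}"
| "vars One = {}"
| "vars (Mult s t) = vars s \<union> vars t"
| "vars (Meet s t) = vars s \<union> vars t"
| "vars (Join s t) = vars s \<union> vars t"
| "vars (Inv t) = vars t"

text \<open>\<open>None\<close> means that the term is undefined at the given tuple: some subterm \<open>Join s t\<close> has
  incompatible (or undefined) arguments.\<close>

primrec value_at :: "('a, 'm) monoid_scheme \<Rightarrow> (nat \<Rightarrow> 'a) \<Rightarrow> dis_term \<Rightarrow> 'a option" where
  "value_at G v (Var i) = Some (v i)"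
| "value_at G v Zero = Some (sg_zero G)"
| "value_at G v One = Some \<one>\<^bsub>G\<^esub>"
| "value_at G v (Mult s t) =
     Option.bind (value_at G v s) (\<lambda>a. Option.bind (value_at G v t) (\<lambda>b. Some (a \<otimes>\<^bsub>G\<^esub> b)))"
| "value_at G v (Meet s t) =
     Option.bind (value_at G v s) (\<lambda>a. Option.bind (value_at G v t) (\<lambda>b.
       Some (a \<sqinter>\<^bsub>nat_order G\<^esub> b)))"
| "value_at G v (Join s t) =
     Option.bind (value_at G v s) (\<lambda>a. Option.bind (value_at G v t) (\<lambda>b.
       if compatible G a b then Some (a \<squnion>\<^bsub>nat_order G\<^esub> b) else None))"
| "value_at G v (Inv t) = Option.bind (value_at G v t) (\<lambda>a. Some (sg_inv G a))"

definition satisfies_le ::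
    "('a, 'm) monoid_scheme \<Rightarrow> nat \<Rightarrow> dis_term \<Rightarrow> dis_term \<Rightarrow> bool" where
  "satisfies_le G n \<phi> \<psi> \<longleftrightarrow>
     (\<forall>v \<in> {1..n} \<rightarrow> carrier G. \<forall>a b. value_at G v \<phi> = Some a \<longrightarrow> value_at G v \<psi> = Some b
        \<longrightarrow> a \<sqsubseteq>\<^bsub>nat_order G\<^esub> b)"

section \<open>Partial bijections\<close>

text \<open>A partial bijection is its graph \<open>{(x, f x)}\<close>. The library's \<open>g O f\<close> applies \<open>g\<close> first, so
  \<open>f \<circ> g\<close> is \<open>g O f\<close>.

  HOL cannot quantify over all sets inside a hypothesis, only over all sets \<open>X\<close> with points in one
  type. For a semigroup with elements in \<open>'a\<close>, the point type used is \<open>'a set\<close>, which contains e.g. all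
  filters of the semigroup. Points from any larger type make the hypothesis on the \<open>sym_inv X\<close>
  stronger, because sets over \<open>'a set\<close> embed there and the inequality transfers along bijections of \<open>X\<close>.\<close>

definition partial_bijections :: "'x set \<Rightarrow> ('x \<times> 'x) set set" where
  "partial_bijections X = {f. f \<subseteq> X \<times> X \<and> single_valued f \<and> single_valued (f\<inverse>)}"

definition sym_inv :: "'x set \<Rightarrow> ('x \<times> 'x) set monoid" where
  "sym_inv X = \<lparr>carrier = partial_bijections X, mult = (\<lambda>f g. g O f), one = Id_on X\<rparr>"

text \<open>The intrinsically defined operations of \<open>sym_inv X\<close> are the expected concrete ones.\<close>

lemma sym_inv_simps [simp]:
  "carrier (sym_inv X) = partial_bijections X"
  "f \<otimes>\<^bsub>sym_inv X\<^esub> g = g O f"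
  "\<one>\<^bsub>sym_inv X\<^esub> = Id_on X"
  by (simp_all add: sym_inv_def)

lemma pb_relcomp: "f \<in> partial_bijections X \<Longrightarrow> g \<in> partial_bijections X \<Longrightarrow> f O g \<in> partial_bijections X"
  unfolding partial_bijections_def single_valued_def by blast

lemma pb_converse: "f \<in> partial_bijections X \<Longrightarrow> f\<inverse> \<in> partial_bijections X"
  unfolding partial_bijections_def single_valued_def by blast

lemma pb_subset: "f \<in> partial_bijections X \<Longrightarrow> g \<subseteq> f \<Longrightarrow> g \<in> partial_bijections X"
  unfolding partial_bijections_def single_valued_def by blast

lemma pb_Id_on: "Y \<subseteq> X \<Longrightarrow> Id_on Y \<in> partial_bijections X"
  unfolding partial_bijections_def single_valued_def by blast

lemma pb_inverse_iff:
  assumes f: "f \<in> partial_bijections X" and g: "g \<in> partial_bijections X"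
  shows "f O g O f = f \<and> g O f O g = g \<longleftrightarrow> g = f\<inverse>"
proof
  assume eq: "f O g O f = f \<and> g O f O g = g"
  have "f\<inverse> \<subseteq> g"
  proof (rule subrelI)
    fix y x assume "(y, x) \<in> f\<inverse>"
    then have xy: "(x, y) \<in> f" by simp
    then have "(x, y) \<in> f O g O f" using eq by simp
    then obtain u w where "(x, u) \<in> f" "(u, w) \<in> g" "(w, y) \<in> f" by blast
    with xy f show "(y, x) \<in> g"
      unfolding partial_bijections_def single_valued_def by blast
  qed
  moreover have "g \<subseteq> f\<inverse>"
  proof (rule subrelI)
    fix x y assume xy: "(x, y) \<in> g"
    then have "(x, y) \<in> g O f O g" using eq by simp
    then obtain u w where "(x, u) \<in> g" "(u, w) \<in> f" "(w, y) \<in> g" by blast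
    with xy g show "(x, y) \<in> f\<inverse>"
      unfolding partial_bijections_def single_valued_def by blast
  qed
  ultimately show "g = f\<inverse>" by blast
next
  assume "g = f\<inverse>"
  then show "f O g O f = f \<and> g O f O g = g"
    using f unfolding partial_bijections_def single_valued_def by blast
qed

lemma sym_inv_inverse_semigroup: "inverse_semigroup (sym_inv X)"
proof
  fix f assume "f \<in> carrier (sym_inv X)"
  then have f: "f \<in> partial_bijections X" by simp
  show "\<exists>!g. g \<in> carrier (sym_inv X) \<and> f \<otimes>\<^bsub>sym_inv X\<^esub> g \<otimes>\<^bsub>sym_inv X\<^esub> f = f \<and>
      g \<otimes>\<^bsub>sym_inv X\<^esub> f \<otimes>\<^bsub>sym_inv X\<^esub> g = g"
    using pb_inverse_iff[OF f] pb_converse[OF f]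
    by (intro ex1I[of _ "f\<inverse>"]) (simp_all add: O_assoc, blast)
qed (auto simp: pb_relcomp O_assoc)

lemma sym_inv_inv: "f \<in> partial_bijections X \<Longrightarrow> sg_inv (sym_inv X) f = f\<inverse>"
  unfolding sg_inv_def using pb_inverse_iff[of f X] pb_converse[of f X]
  by (intro the_equality) (simp_all add: O_assoc, blast)

lemma sym_inv_idems: "idems (sym_inv X) = Id_on ` Pow X"
proof
  show "idems (sym_inv X) \<subseteq> Id_on ` Pow X"
  proof
    fix e assume "e \<in> idems (sym_inv X)"
    then have e: "e \<in> partial_bijections X" "e O e = e" by (auto simp: idems_def)
    have "e = Id_on (Domain e)"
    proof
      show "e \<subseteq> Id_on (Domain e)"
      proof (rule subrelI)
        fix x y assume xy: "(x, y) \<in> e"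
        then obtain w where w: "(x, w) \<in> e" "(w, y) \<in> e" using e(2) by blast
        with xy e(1) have "w = y" "w = x"
          unfolding partial_bijections_def single_valued_def by blast+
        with xy show "(x, y) \<in> Id_on (Domain e)" by blast
      qed
      then show "Id_on (Domain e) \<subseteq> e" by blast
    qed
    moreover have "Domain e \<subseteq> X" using e(1) unfolding partial_bijections_def by blast
    ultimately show "e \<in> Id_on ` Pow X" by blast
  qed
  show "Id_on ` Pow X \<subseteq> idems (sym_inv X)"
    by (auto simp: idems_def pb_Id_on)
qed

lemma sym_inv_le:
  assumes "f \<in> partial_bijections X" "g \<in> partial_bijections X"
  shows "f \<sqsubseteq>\<^bsub>nat_order (sym_inv X)\<^esub> g \<longleftrightarrow> f \<subseteq> g"
proof
  assume "f \<sqsubseteq>\<^bsub>nat_order (sym_inv X)\<^esub> g"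
  then show "f \<subseteq> g" by (auto simp: nat_order_def sym_inv_idems)
next
  assume "f \<subseteq> g"
  then have "f = Id_on (Domain f) O g"
    using assms(2) unfolding partial_bijections_def single_valued_def by blast
  moreover have "Domain f \<subseteq> X" using assms(1) unfolding partial_bijections_def by blast
  ultimately show "f \<sqsubseteq>\<^bsub>nat_order (sym_inv X)\<^esub> g"
    by (auto simp: nat_order_def sym_inv_idems)
qed

lemma sym_inv_compatible:
  assumes f: "f \<in> partial_bijections X" and g: "g \<in> partial_bijections X"
  shows "compatible (sym_inv X) f g \<longleftrightarrow> f \<union> g \<in> partial_bijections X"
proof -
  have Id: "h \<in> Id_on ` Pow X \<longleftrightarrow> h \<subseteq> Id \<and> h \<subseteq> X \<times> X" for h :: "('a \<times> 'a) set"
  proof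
    assume "h \<subseteq> Id \<and> h \<subseteq> X \<times> X"
    then have "h = Id_on (Domain h)" "Domain h \<subseteq> X" by (auto simp: Domain.simps Id_on_def)
    then show "h \<in> Id_on ` Pow X" by blast
  qed auto
  have sub: "g\<inverse> O f \<subseteq> X \<times> X" "g O f\<inverse> \<subseteq> X \<times> X"
    using f g unfolding partial_bijections_def by blast+
  have "compatible (sym_inv X) f g \<longleftrightarrow> g\<inverse> O f \<subseteq> Id \<and> g O f\<inverse> \<subseteq> Id"
    using sub by (simp add: compatible_def sym_inv_inv f g sym_inv_idems Id)
  also have "\<dots> \<longleftrightarrow> f \<union> g \<in> partial_bijections X"
  proof
    assume "g\<inverse> O f \<subseteq> Id \<and> g O f\<inverse> \<subseteq> Id"
    then have "\<And>x y z. (x, y) \<in> f \<Longrightarrow> (x, z) \<in> g \<Longrightarrow> y = z" "\<And>x y z. (y, x) \<in> f \<Longrightarrow> (z, x) \<in> g \<Longrightarrow> y = z"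
      by blast+
    then show "f \<union> g \<in> partial_bijections X"
      using f g by (auto simp: partial_bijections_def single_valued_def) metis+
  next
    assume "f \<union> g \<in> partial_bijections X"
    then have "single_valued (f \<union> g)" "single_valued ((f \<union> g)\<inverse>)"
      by (auto simp: partial_bijections_def)
    then show "g\<inverse> O f \<subseteq> Id \<and> g O f\<inverse> \<subseteq> Id"
      by (auto simp: single_valued_def)
  qed
  finally show ?thesis .
qed

lemma nat_order_carrier [simp]: "carrier (nat_order G) = carrier G"
  by (simp add: nat_order_def)

lemma sym_inv_greatest:
  assumes f: "f \<in> partial_bijections X" and g: "g \<in> partial_bijections X"
  shows "greatest (nat_order (sym_inv X)) m (Lower (nat_order (sym_inv X)) {f, g}) \<longleftrightarrow> m = f \<inter> g"
proof -
  have L: "Lower (nat_order (sym_inv X)) {f, g} = {h \<in> partial_bijections X. h \<subseteq> f \<inter> g}"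
  proof (rule Set.set_eqI)
    fix h
    show "h \<in> Lower (nat_order (sym_inv X)) {f, g} \<longleftrightarrow> h \<in> {h \<in> partial_bijections X. h \<subseteq> f \<inter> g}"
      using f g sym_inv_le[of h X f] sym_inv_le[of h X g] unfolding Lower_def by simp blast
  qed
  have fg: "f \<inter> g \<in> partial_bijections X" by (rule pb_subset[OF f]) simp
  show ?thesis
  proof
    assume "greatest (nat_order (sym_inv X)) m (Lower (nat_order (sym_inv X)) {f, g})"
    then have "m \<in> partial_bijections X" "m \<subseteq> f \<inter> g" "f \<inter> g \<sqsubseteq>\<^bsub>nat_order (sym_inv X)\<^esub> m"
      using fg by (auto simp: greatest_def L)
    then show "m = f \<inter> g" using fg by (auto simp: sym_inv_le)
  qed (auto simp: greatest_def L fg sym_inv_le)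
qed

lemma sym_inv_least:
  assumes f: "f \<in> partial_bijections X" and g: "g \<in> partial_bijections X"
    and fg: "f \<union> g \<in> partial_bijections X"
  shows "least (nat_order (sym_inv X)) j (Upper (nat_order (sym_inv X)) {f, g}) \<longleftrightarrow> j = f \<union> g"
proof -
  have U: "Upper (nat_order (sym_inv X)) {f, g} = {h \<in> partial_bijections X. f \<union> g \<subseteq> h}"
  proof (rule Set.set_eqI)
    fix h
    show "h \<in> Upper (nat_order (sym_inv X)) {f, g} \<longleftrightarrow> h \<in> {h \<in> partial_bijections X. f \<union> g \<subseteq> h}"
      using f g sym_inv_le[of f X h] sym_inv_le[of g X h] unfolding Upper_def by simp blast
  qed
  show ?thesis
  proof
    assume "least (nat_order (sym_inv X)) j (Upper (nat_order (sym_inv X)) {f, g})"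
    then have "j \<in> partial_bijections X" "f \<union> g \<subseteq> j" "j \<sqsubseteq>\<^bsub>nat_order (sym_inv X)\<^esub> f \<union> g"
      using fg by (auto simp: least_def U)
    then show "j = f \<union> g" using fg by (auto simp: sym_inv_le)
  qed (auto simp: least_def U fg sym_inv_le)
qed

lemma sym_inv_meet:
  "f \<in> partial_bijections X \<Longrightarrow> g \<in> partial_bijections X \<Longrightarrow> f \<sqinter>\<^bsub>nat_order (sym_inv X)\<^esub> g = f \<inter> g"
  by (simp add: meet_def inf_def sym_inv_greatest)

lemma sym_inv_join:
  "f \<in> partial_bijections X \<Longrightarrow> g \<in> partial_bijections X \<Longrightarrow> f \<union> g \<in> partial_bijections X
    \<Longrightarrow> f \<squnion>\<^bsub>nat_order (sym_inv X)\<^esub> g = f \<union> g"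
  by (simp add: join_def sup_def sym_inv_least)

lemma sym_inv_is_zero: "is_zero (sym_inv X) z \<longleftrightarrow> z = {}"
proof
  have e: "{} \<in> partial_bijections X" using pb_Id_on[of "{}" X] by simp
  show "z = {}" if "is_zero (sym_inv X) z" using that e by (auto simp: is_zero_def)
  show "is_zero (sym_inv X) z" if "z = {}" using that e by (auto simp: is_zero_def)
qed

lemma sym_inv_zero: "sg_zero (sym_inv X) = {}"
  by (simp add: sg_zero_def sym_inv_is_zero)

lemma sym_inv_distributive: "distributive_inverse_semigroup (sym_inv X)"
proof (intro distributive_inverse_semigroup.intro distributive_inverse_semigroup_axioms.intro
    sym_inv_inverse_semigroup)
  show "monoid (sym_inv X)"
  proof (unfold_locales, goal_cases)
    case (4 f)
    then show ?case unfolding sym_inv_simps partial_bijections_def by blast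
  next
    case (5 f)
    then show ?case unfolding sym_inv_simps partial_bijections_def by blast
  qed (auto simp: pb_relcomp pb_Id_on O_assoc)
next
  fix f g h assume fgh: "f \<in> carrier (sym_inv X)" "g \<in> carrier (sym_inv X)"
    "h \<in> carrier (sym_inv X)" "compatible (sym_inv X) f g"
  then have *: "f \<in> partial_bijections X" "g \<in> partial_bijections X" "h \<in> partial_bijections X"
    "f \<union> g \<in> partial_bijections X"
    by (simp_all add: sym_inv_compatible)
  have "f O h \<union> g O h \<in> partial_bijections X" "h O f \<union> h O g \<in> partial_bijections X"
    using pb_relcomp[OF *(4) *(3)] pb_relcomp[OF *(3) *(4)]
    by (simp_all only: relcomp_distrib relcomp_distrib2)
  with * show "h \<otimes>\<^bsub>sym_inv X\<^esub> (f \<squnion>\<^bsub>nat_order (sym_inv X)\<^esub> g) =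
      h \<otimes>\<^bsub>sym_inv X\<^esub> f \<squnion>\<^bsub>nat_order (sym_inv X)\<^esub> (h \<otimes>\<^bsub>sym_inv X\<^esub> g)"
    and "(f \<squnion>\<^bsub>nat_order (sym_inv X)\<^esub> g) \<otimes>\<^bsub>sym_inv X\<^esub> h =
      f \<otimes>\<^bsub>sym_inv X\<^esub> h \<squnion>\<^bsub>nat_order (sym_inv X)\<^esub> (g \<otimes>\<^bsub>sym_inv X\<^esub> h)"
    by (simp_all add: sym_inv_join pb_relcomp relcomp_distrib relcomp_distrib2)
qed (auto simp: sym_inv_is_zero sym_inv_greatest sym_inv_least sym_inv_compatible)

end

theory Submission
  imports Defs
begin

text \<open>A distributive inverse semigroup embeds into the partial bijections of its set of prime filters,
  and the embedding respects every operation. The element \<open>a\<close> acts by relating \<open>P\<close> to \<open>Q\<close> iff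
  \<open>a P \<subseteq> Q\<close> and \<open>a\<^sup>-\<^sup>1 Q \<subseteq> P\<close>, a condition symmetric under inversion. If \<open>c\<close> is not below \<open>d\<close>, Zorn's
  lemma yields a filter maximal among those containing \<open>c\<close> and omitting \<open>d\<close>; distributivity makes it
  prime, and it separates the actions of \<open>c\<close> and \<open>d\<close>. An inequality valid in the symmetric inverse
  monoids therefore pulls back along the embedding.\<close>

section \<open>Inverse semigroups and the natural order\<close>

context inverse_semigroup
begin

abbreviation iinv :: "'a \<Rightarrow> 'a" ("\<iota>") where "\<iota> \<equiv> sg_inv G"
abbreviation ile :: "'a \<Rightarrow> 'a \<Rightarrow> bool" (infix "\<preceq>" 50) where "a \<preceq> b \<equiv> a \<sqsubseteq>\<^bsub>nat_order G\<^esub> b"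

declare mult_closed [simp] mult_assoc [simp]

section \<open>Inverses and cancellation\<close>

lemma sg_inv_props:
  assumes "a \<in> carrier G"
  shows "\<iota> a \<in> carrier G \<and> a \<otimes> \<iota> a \<otimes> a = a \<and> \<iota> a \<otimes> a \<otimes> \<iota> a = \<iota> a"
  unfolding sg_inv_def by (rule theI') (rule unique_inverse[OF assms])

lemma iinv_closed [simp]: "a \<in> carrier G \<Longrightarrow> \<iota> a \<in> carrier G"
  using sg_inv_props by blast

lemma inv_cancel [simp]:
  assumes "a \<in> carrier G"
  shows "a \<otimes> (\<iota> a \<otimes> a) = a" and "\<iota> a \<otimes> (a \<otimes> \<iota> a) = \<iota> a"
  using sg_inv_props[OF assms] assms by simp_all

text \<open>Products are normalised to right-nested form, where \<open>inv_cancel\<close> does not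
  match inside a longer product; hence the versions with a trailing factor \<open>x\<close>.\<close>

lemma inv_cancel_left [simp]:
  assumes "a \<in> carrier G" "x \<in> carrier G"
  shows "a \<otimes> (\<iota> a \<otimes> (a \<otimes> x)) = a \<otimes> x" and "\<iota> a \<otimes> (a \<otimes> (\<iota> a \<otimes> x)) = \<iota> a \<otimes> x"
  using arg_cong[OF inv_cancel(1)[OF assms(1)], of "\<lambda>y. y \<otimes> x"]
    arg_cong[OF inv_cancel(2)[OF assms(1)], of "\<lambda>y. y \<otimes> x"] assms
  by (simp_all del: inv_cancel)

lemma sg_inv_eqI:
  assumes "a \<in> carrier G" "b \<in> carrier G" "a \<otimes> (b \<otimes> a) = a" "b \<otimes> (a \<otimes> b) = b"
  shows "\<iota> a = b"
  unfolding sg_inv_def by (rule the1_equality[OF unique_inverse[OF assms(1)]]) (use assms in simp)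

lemma inv_inv [simp]: "a \<in> carrier G \<Longrightarrow> \<iota> (\<iota> a) = a"
  by (rule sg_inv_eqI) simp_all

section \<open>Idempotents and the inverse of a product\<close>

lemma idem_closed [simp]: "e \<in> idems G \<Longrightarrow> e \<in> carrier G"
  by (simp add: idems_def)

lemma idem_idem [simp]: "e \<in> idems G \<Longrightarrow> e \<otimes> e = e"
  unfolding idems_def by blast

lemma idemI: "e \<in> carrier G \<Longrightarrow> e \<otimes> e = e \<Longrightarrow> e \<in> idems G"
  unfolding idems_def by blast

lemma idem_idem_left [simp]: "e \<in> idems G \<Longrightarrow> x \<in> carrier G \<Longrightarrow> e \<otimes> (e \<otimes> x) = e \<otimes> x"
  using mult_assoc[of e e x] by (simp del: mult_assoc)

lemma inv_idem [simp]: "e \<in> idems G \<Longrightarrow> \<iota> e = e"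
  by (rule sg_inv_eqI) simp_all

lemma idem_inv_mult [simp]: "a \<in> carrier G \<Longrightarrow> \<iota> a \<otimes> a \<in> idems G"
  by (rule idemI) simp_all

lemma idem_mult_inv [simp]: "a \<in> carrier G \<Longrightarrow> a \<otimes> \<iota> a \<in> idems G"
  by (rule idemI) simp_all

text \<open>Let \<open>x\<close> be the inverse of \<open>e \<otimes> f\<close>. Then
  \<open>f \<otimes> (x \<otimes> e)\<close> is an inverse of \<open>e \<otimes> f\<close> too, so
  it equals \<open>x\<close>; in this form \<open>x\<close> is visibly idempotent. An idempotent is
  its own inverse, so \<open>e \<otimes> f\<close> equals \<open>x\<close>.\<close>

lemma idem_mult [simp]:
  assumes e: "e \<in> idems G" and f: "f \<in> idems G"
  shows "e \<otimes> f \<in> idems G"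
proof -
  let ?x = "\<iota> (e \<otimes> f)"
  have c: "e \<in> carrier G" "f \<in> carrier G" "?x \<in> carrier G" using e f by simp_all
  have 1: "e \<otimes> (f \<otimes> (?x \<otimes> (e \<otimes> f))) = e \<otimes> f"
    using inv_cancel(1)[of "e \<otimes> f"] c by (simp del: inv_cancel)
  have 2: "?x \<otimes> (e \<otimes> (f \<otimes> ?x)) = ?x"
    using inv_cancel(2)[of "e \<otimes> f"] c by (simp del: inv_cancel)
  have 3: "?x \<otimes> (e \<otimes> (f \<otimes> (?x \<otimes> y))) = ?x \<otimes> y" if "y \<in> carrier G" for y
    using arg_cong[OF 2, of "\<lambda>z. z \<otimes> y"] c that by simp
  have x: "?x = f \<otimes> (?x \<otimes> e)"
    using e f c 1 3 by (intro sg_inv_eqI) simp_all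
  have "?x \<otimes> ?x = (f \<otimes> (?x \<otimes> e)) \<otimes> (f \<otimes> (?x \<otimes> e))"
    by (rule arg_cong2[OF x x])
  also have "\<dots> = f \<otimes> (?x \<otimes> e)" using c 3 by simp
  also have "\<dots> = ?x" by (rule x[symmetric])
  finally have "?x \<in> idems G" by (rule idemI[OF c(3)])
  then show ?thesis using inv_inv[of "e \<otimes> f"] c inv_idem[of ?x] by simp
qed

text \<open>Since both products are idempotent, \<open>f \<otimes> e\<close> is an inverse of
  \<open>e \<otimes> f\<close>. So is \<open>e \<otimes> f\<close> itself, and inverses are
  unique.\<close>

lemma idem_commute:
  assumes e: "e \<in> idems G" and f: "f \<in> idems G"
  shows "e \<otimes> f = f \<otimes> e"
proof -
  have "e \<otimes> (f \<otimes> (e \<otimes> f)) = e \<otimes> f" "f \<otimes> (e \<otimes> (f \<otimes> e)) = f \<otimes> e"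
    using idem_idem[OF idem_mult[OF e f]] idem_idem[OF idem_mult[OF f e]] e f
    by (simp_all del: idem_idem)
  then have "\<iota> (e \<otimes> f) = f \<otimes> e" using e f by (intro sg_inv_eqI) simp_all
  then show ?thesis using inv_idem[OF idem_mult[OF e f]] by simp
qed

lemma idem_commute_left:
  assumes "e \<in> idems G" "f \<in> idems G" "x \<in> carrier G"
  shows "e \<otimes> (f \<otimes> x) = f \<otimes> (e \<otimes> x)"
  using arg_cong[OF idem_commute[OF assms(1,2)], of "\<lambda>y. y \<otimes> x"] assms by simp

lemma inv_mult_idem_commute:
  assumes "a \<in> carrier G" "e \<in> idems G"
  shows "\<iota> a \<otimes> (a \<otimes> e) = e \<otimes> (\<iota> a \<otimes> a)"
  using idem_commute[of "\<iota> a \<otimes> a" e] assms by simp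

lemma inv_mult_idem_commute_left:
  assumes "a \<in> carrier G" "e \<in> idems G" "x \<in> carrier G"
  shows "\<iota> a \<otimes> (a \<otimes> (e \<otimes> x)) = e \<otimes> (\<iota> a \<otimes> (a \<otimes> x))"
  using idem_commute_left[of "\<iota> a \<otimes> a" e x] assms by simp

text \<open>The idempotents \<open>b \<otimes> \<iota> b\<close> and
  \<open>\<iota> a \<otimes> a\<close> commute; swapping them in the middle of each product lets
  both cancellations happen.\<close>

lemma inv_mult:
  assumes a: "a \<in> carrier G" and b: "b \<in> carrier G"
  shows "\<iota> (a \<otimes> b) = \<iota> b \<otimes> \<iota> a"
proof (rule sg_inv_eqI)
  have "b \<otimes> (\<iota> b \<otimes> (\<iota> a \<otimes> (a \<otimes> b))) = \<iota> a \<otimes> (a \<otimes> b)"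
    using idem_commute_left[of "b \<otimes> \<iota> b" "\<iota> a \<otimes> a" b] a b by simp
  then show "a \<otimes> b \<otimes> (\<iota> b \<otimes> \<iota> a \<otimes> (a \<otimes> b)) = a \<otimes> b" using a b by simp
  have "\<iota> a \<otimes> (a \<otimes> (b \<otimes> (\<iota> b \<otimes> \<iota> a))) = b \<otimes> (\<iota> b \<otimes> \<iota> a)"
    using idem_commute_left[of "\<iota> a \<otimes> a" "b \<otimes> \<iota> b" "\<iota> a"] a b by simp
  then show "\<iota> b \<otimes> \<iota> a \<otimes> (a \<otimes> b \<otimes> (\<iota> b \<otimes> \<iota> a)) = \<iota> b \<otimes> \<iota> a" using a b by simp
qed (use a b in simp_all)

lemma idem_conj:
  assumes "a \<in> carrier G" "e \<in> idems G"
  shows "a \<otimes> (e \<otimes> \<iota> a) \<in> idems G"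
  using assms by (intro idemI) (simp_all add: inv_mult_idem_commute_left)

section \<open>The natural order\<close>

lemma ile_iff: "a \<preceq> b \<longleftrightarrow> (\<exists>e\<in>idems G. a = b \<otimes> e)"
  by (simp add: nat_order_def)

lemma ileI: "e \<in> idems G \<Longrightarrow> a = b \<otimes> e \<Longrightarrow> a \<preceq> b"
  by (auto simp: ile_iff)

lemma ileE:
  assumes "a \<preceq> b"
  obtains e where "e \<in> idems G" "a = b \<otimes> e"
  using assms by (auto simp: ile_iff)

text \<open>The order is defined by idempotents on the right. One on the left can be moved across
  \<open>a\<close> by conjugation, because \<open>e\<close> commutes with
  \<open>a \<otimes> \<iota> a\<close>.\<close>

lemma idem_mult_le:
  assumes "e \<in> idems G" "a \<in> carrier G"
  shows "e \<otimes> a \<preceq> a"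
proof (rule ileI)
  show "\<iota> a \<otimes> (e \<otimes> a) \<in> idems G" using idem_conj[of "\<iota> a" e] assms by simp
  show "e \<otimes> a = a \<otimes> (\<iota> a \<otimes> (e \<otimes> a))"
    using idem_commute_left[of "a \<otimes> \<iota> a" e a] assms by simp
qed

lemma ile_refl: "a \<in> carrier G \<Longrightarrow> a \<preceq> a"
  by (rule ileI[of "\<iota> a \<otimes> a"]) simp_all

lemma ile_trans:
  assumes "a \<preceq> b" "b \<preceq> c" "c \<in> carrier G"
  shows "a \<preceq> c"
  using assms by (elim ileE) (auto intro: ileI[OF idem_mult])

lemma ile_mult_left:
  assumes "a \<preceq> b" "b \<in> carrier G" "c \<in> carrier G"
  shows "c \<otimes> a \<preceq> c \<otimes> b"
  using assms by (elim ileE) (auto intro: ileI)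

lemma ile_mult_right:
  assumes "a \<preceq> b" "b \<in> carrier G" "c \<in> carrier G"
  shows "a \<otimes> c \<preceq> b \<otimes> c"
proof -
  from assms(1) obtain e where e: "e \<in> idems G" "a = b \<otimes> e" by (rule ileE)
  then show ?thesis using ile_mult_left[OF idem_mult_le[of e c]] assms by simp
qed

lemma ile_inv:
  assumes "a \<preceq> b" "b \<in> carrier G"
  shows "\<iota> a \<preceq> \<iota> b"
proof -
  from assms(1) obtain e where e: "e \<in> idems G" "a = b \<otimes> e" by (rule ileE)
  then show ?thesis using idem_mult_le[of e "\<iota> b"] assms by (simp add: inv_mult)
qed

text \<open>This makes the idempotent witnessing the order canonical: the domain idempotent
  \<open>\<iota> a \<otimes> a\<close> of the smaller element always serves.\<close>

lemma ile_restrict: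
  assumes "a \<preceq> b" "b \<in> carrier G"
  shows "a = b \<otimes> (\<iota> a \<otimes> a)"
proof -
  from assms(1) obtain e where e: "e \<in> idems G" "a = b \<otimes> e" by (rule ileE)
  have "e \<otimes> (\<iota> b \<otimes> (b \<otimes> e)) = \<iota> b \<otimes> (b \<otimes> e)"
    using inv_mult_idem_commute_left[of b e e] e assms by simp
  then show ?thesis using e assms by (simp add: inv_mult)
qed

lemma mult_inv_le:
  assumes "a \<preceq> b" "b \<in> carrier G"
  shows "b \<otimes> (\<iota> b \<otimes> a) = a"
  using assms by (elim ileE) auto

text \<open>Writing \<open>c\<close> as \<open>a \<otimes> e\<close>, both sides reduce to
  \<open>e \<otimes> \<iota> a\<close>. The formula recovers the inverse of \<open>c\<close> from
  \<open>c\<close> and the inverse of an upper bound.\<close>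

lemma ile_sandwich:
  assumes "c \<preceq> a" "a \<in> carrier G"
  shows "\<iota> a \<otimes> (c \<otimes> \<iota> a) = \<iota> c"
proof -
  from assms(1) obtain e where e: "e \<in> idems G" "c = a \<otimes> e" by (rule ileE)
  then show ?thesis using assms by (simp add: inv_mult inv_mult_idem_commute_left)
qed

text \<open>For \<open>a = j \<otimes> e\<close> and \<open>b = j \<otimes> f\<close>, one product
  is a conjugate of the idempotent \<open>e \<otimes> f\<close> and the other is a product of three
  idempotents. Translates of a compatible pair are bounded by the translated join, so they are
  compatible by this lemma.\<close>

lemma compatible_if_bounded:
  assumes "a \<preceq> j" "b \<preceq> j" "j \<in> carrier G"
  shows "compatible G a b"
proof -
  from assms obtain e f where e: "e \<in> idems G" "a = j \<otimes> e" and f: "f \<in> idems G" "b = j \<otimes> f"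
    by (elim ileE)
  have "a \<otimes> \<iota> b \<in> idems G"
    using idem_conj[of j "e \<otimes> f"] e f assms(3) by (simp add: inv_mult)
  moreover have "\<iota> a \<otimes> b \<in> idems G"
    using idem_mult[of e "(\<iota> j \<otimes> j) \<otimes> f"] idem_mult[of "\<iota> j \<otimes> j" f] e f assms(3)
    by (simp add: inv_mult)
  ultimately show ?thesis by (simp add: compatible_def)
qed

end

section \<open>Filters\<close>

context distributive_inverse_semigroup
begin

abbreviation imeet :: "'a \<Rightarrow> 'a \<Rightarrow> 'a" where "imeet a b \<equiv> a \<sqinter>\<^bsub>nat_order G\<^esub> b"
abbreviation ijoin :: "'a \<Rightarrow> 'a \<Rightarrow> 'a" where "ijoin a b \<equiv> a \<squnion>\<^bsub>nat_order G\<^esub> b"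

section \<open>Meets, joins and zero\<close>

lemma imeet_props:
  assumes "a \<in> carrier G" "b \<in> carrier G"
  shows imeet_closed: "imeet a b \<in> carrier G"
    and imeet_le1: "imeet a b \<preceq> a" and imeet_le2: "imeet a b \<preceq> b"
    and imeet_greatest: "c \<in> carrier G \<Longrightarrow> c \<preceq> a \<Longrightarrow> c \<preceq> b \<Longrightarrow> c \<preceq> imeet a b"
proof -
  have "greatest (nat_order G) (imeet a b) (Lower (nat_order G) {a, b})"
    unfolding meet_def inf_def using meet_exists[OF assms] by (rule someI_ex)
  then show "imeet a b \<in> carrier G" "imeet a b \<preceq> a" "imeet a b \<preceq> b"
    "c \<in> carrier G \<Longrightarrow> c \<preceq> a \<Longrightarrow> c \<preceq> b \<Longrightarrow> c \<preceq> imeet a b"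
    using assms by (auto simp: greatest_def Lower_def)
qed

lemma ijoin_props:
  assumes "a \<in> carrier G" "b \<in> carrier G" "compatible G a b"
  shows ijoin_closed: "ijoin a b \<in> carrier G"
    and ijoin_ge1: "a \<preceq> ijoin a b" and ijoin_ge2: "b \<preceq> ijoin a b"
    and ijoin_least: "c \<in> carrier G \<Longrightarrow> a \<preceq> c \<Longrightarrow> b \<preceq> c \<Longrightarrow> ijoin a b \<preceq> c"
proof -
  have "least (nat_order G) (ijoin a b) (Upper (nat_order G) {a, b})"
    unfolding join_def sup_def using join_exists[OF assms] by (rule someI_ex)
  then show "ijoin a b \<in> carrier G" "a \<preceq> ijoin a b" "b \<preceq> ijoin a b"
    "c \<in> carrier G \<Longrightarrow> a \<preceq> c \<Longrightarrow> b \<preceq> c \<Longrightarrow> ijoin a b \<preceq> c"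
    using assms by (auto simp: least_def Upper_def)
qed

lemma compatible_mult_left:
  assumes "a \<in> carrier G" "b \<in> carrier G" "compatible G a b" "c \<in> carrier G"
  shows "compatible G (c \<otimes> a) (c \<otimes> b)"
  using assms ijoin_props[OF assms(1-3)]
  by (intro compatible_if_bounded[of _ "c \<otimes> ijoin a b"] ile_mult_left) simp_all

lemma compatible_mult_right:
  assumes "a \<in> carrier G" "b \<in> carrier G" "compatible G a b" "c \<in> carrier G"
  shows "compatible G (a \<otimes> c) (b \<otimes> c)"
  using assms ijoin_props[OF assms(1-3)]
  by (intro compatible_if_bounded[of _ "ijoin a b \<otimes> c"] ile_mult_right) simp_all

lemma is_zero_sg_zero: "is_zero G (sg_zero G)"
proof -
  obtain z where z: "is_zero G z" using zero_exists by blast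
  moreover have "z' = z" if "is_zero G z'" for z' using that z unfolding is_zero_def by metis
  ultimately show ?thesis unfolding sg_zero_def by (rule theI)
qed

lemma zero_closed [simp]: "sg_zero G \<in> carrier G"
  and zero_mult [simp]: "a \<in> carrier G \<Longrightarrow> sg_zero G \<otimes> a = sg_zero G"
  and mult_zero [simp]: "a \<in> carrier G \<Longrightarrow> a \<otimes> sg_zero G = sg_zero G"
  using is_zero_sg_zero by (auto simp: is_zero_def)

lemma zero_le: "a \<in> carrier G \<Longrightarrow> sg_zero G \<preceq> a"
  by (rule ileI[of "sg_zero G"]) (simp_all add: idemI)

lemma sg_inv_one: "\<iota> \<one> = \<one>"
  by (rule sg_inv_eqI) simp_all

definition sg_filter :: "'a set \<Rightarrow> bool" where
  "sg_filter P \<longleftrightarrow> P \<subseteq> carrier G \<and> P \<noteq> {}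
     \<and> (\<forall>x\<in>P. \<forall>y\<in>carrier G. x \<preceq> y \<longrightarrow> y \<in> P)
     \<and> (\<forall>x\<in>P. \<forall>y\<in>P. \<exists>z\<in>P. z \<preceq> x \<and> z \<preceq> y)"

definition prime_filter :: "'a set \<Rightarrow> bool" where
  "prime_filter P \<longleftrightarrow> sg_filter P \<and> sg_zero G \<notin> P
     \<and> (\<forall>a\<in>carrier G. \<forall>b\<in>carrier G. compatible G a b \<longrightarrow> ijoin a b \<in> P \<longrightarrow> a \<in> P \<or> b \<in> P)"

lemma filter_closed: "sg_filter P \<Longrightarrow> x \<in> P \<Longrightarrow> x \<in> carrier G"
  and filter_up: "sg_filter P \<Longrightarrow> x \<in> P \<Longrightarrow> x \<preceq> y \<Longrightarrow> y \<in> carrier G \<Longrightarrow> y \<in> P"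
  and filter_nonempty: "sg_filter P \<Longrightarrow> P \<noteq> {}"
  unfolding sg_filter_def by blast+

lemma filter_directed:
  assumes "sg_filter P" "x \<in> P" "y \<in> P"
  obtains z where "z \<in> P" "z \<preceq> x" "z \<preceq> y"
  using assms unfolding sg_filter_def by blast

lemma prime_filterD:
  assumes "prime_filter P"
  shows prime_filter_filter: "sg_filter P"
    and prime_filter_zero: "sg_zero G \<notin> P"
    and prime_filter_prime: "a \<in> carrier G \<Longrightarrow> b \<in> carrier G \<Longrightarrow> compatible G a b \<Longrightarrow> ijoin a b \<in> P
      \<Longrightarrow> a \<in> P \<or> b \<in> P"
  using assms unfolding prime_filter_def by blast+

section \<open>Separation by prime filters\<close>

lemma principal_filter:
  assumes "c \<in> carrier G"
  shows "sg_filter {x \<in> carrier G. c \<preceq> x}"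
  unfolding sg_filter_def using assms ile_refl[of c] ile_trans[of c] by blast

lemma chain_Union_filter:
  assumes "C \<noteq> {}" "\<And>F. F \<in> C \<Longrightarrow> sg_filter F" "\<And>F F'. F \<in> C \<Longrightarrow> F' \<in> C \<Longrightarrow> F \<subseteq> F' \<or> F' \<subseteq> F"
  shows "sg_filter (\<Union>C)"
  unfolding sg_filter_def
proof (intro conjI ballI impI)
  show "\<Union>C \<subseteq> carrier G" using filter_closed assms(2) by blast
  show "\<Union>C \<noteq> {}" using filter_nonempty assms(1,2) by blast
  show "y \<in> \<Union>C" if "x \<in> \<Union>C" "y \<in> carrier G" "x \<preceq> y" for x y
    using that filter_up assms(2) by blast
  show "\<exists>z\<in>\<Union>C. z \<preceq> x \<and> z \<preceq> y" if "x \<in> \<Union>C" "y \<in> \<Union>C" for x y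
  proof -
    from that obtain F where "F \<in> C" "x \<in> F" "y \<in> F" using assms(3) by blast
    then show ?thesis using filter_directed[OF assms(2)] by (metis UnionI)
  qed
qed

text \<open>The inner condition says that \<open>imeet p a\<close> lies below \<open>x\<close>. For
  a filter \<open>P\<close> and \<open>a\<close> in the carrier this is the filter generated by
  \<open>P\<close> and \<open>a\<close>.\<close>

definition adjoin :: "'a set \<Rightarrow> 'a \<Rightarrow> 'a set" where
  "adjoin P a = {x \<in> carrier G. \<exists>p\<in>P. \<forall>y\<in>carrier G. y \<preceq> p \<longrightarrow> y \<preceq> a \<longrightarrow> y \<preceq> x}"

lemma adjoin_superset: "sg_filter P \<Longrightarrow> P \<subseteq> adjoin P a"
  using filter_closed unfolding adjoin_def by blast

lemma adjoin_mem: "sg_filter P \<Longrightarrow> a \<in> carrier G \<Longrightarrow> a \<in> adjoin P a"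
  using filter_nonempty unfolding adjoin_def by blast

lemma adjoin_filter:
  assumes P: "sg_filter P" and a: "a \<in> carrier G"
  shows "sg_filter (adjoin P a)"
  unfolding sg_filter_def
proof (intro conjI ballI impI)
  show "adjoin P a \<subseteq> carrier G" by (auto simp: adjoin_def)
  show "adjoin P a \<noteq> {}" using adjoin_mem[OF P a] by blast
  show "y \<in> adjoin P a" if "x \<in> adjoin P a" "y \<in> carrier G" "x \<preceq> y" for x y
    using that ile_trans unfolding adjoin_def by blast
  show "\<exists>z\<in>adjoin P a. z \<preceq> x \<and> z \<preceq> y" if xy: "x \<in> adjoin P a" "y \<in> adjoin P a" for x y
  proof -
    from xy obtain p q where p: "p \<in> P" "\<forall>z\<in>carrier G. z \<preceq> p \<longrightarrow> z \<preceq> a \<longrightarrow> z \<preceq> x"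
      and q: "q \<in> P" "\<forall>z\<in>carrier G. z \<preceq> q \<longrightarrow> z \<preceq> a \<longrightarrow> z \<preceq> y"
      unfolding adjoin_def by blast
    \<comment> \<open>One element of \<open>P\<close> below both witnesses suffices: its meet with
      \<open>a\<close> is the required common lower bound.\<close>
    obtain r where r: "r \<in> P" "r \<preceq> p" "r \<preceq> q" by (rule filter_directed[OF P p(1) q(1)])
    have c: "r \<in> carrier G" "p \<in> carrier G" "q \<in> carrier G"
      using filter_closed[OF P] r p q by blast+
    note m = imeet_props[OF c(1) a]
    have "imeet r a \<in> adjoin P a"
      using m r(1) unfolding adjoin_def by blast
    moreover have "imeet r a \<preceq> x" "imeet r a \<preceq> y"
      using p(2) q(2) m(1,3) ile_trans[OF m(2) r(2) c(2)] ile_trans[OF m(2) r(3) c(3)] by blast+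
    ultimately show ?thesis by blast
  qed
qed

lemma prime_filter_exists:
  assumes c: "c \<in> carrier G" and d: "d \<in> carrier G" and cd: "\<not> c \<preceq> d"
  obtains P where "prime_filter P" "c \<in> P" "d \<notin> P"
proof -
  let ?\<F> = "{F. sg_filter F \<and> c \<in> F \<and> d \<notin> F}"
  have "\<exists>P\<in>?\<F>. \<forall>F\<in>?\<F>. P \<subseteq> F \<longrightarrow> F = P"
  proof (rule subset_Zorn_nonempty)
    show "?\<F> \<noteq> {}" using principal_filter[OF c] c cd ile_refl by blast
    show "\<Union>C \<in> ?\<F>" if "C \<noteq> {}" "subset.chain ?\<F> C" for C
    proof -
      have "C \<subseteq> ?\<F>" "\<And>F F'. F \<in> C \<Longrightarrow> F' \<in> C \<Longrightarrow> F \<subseteq> F' \<or> F' \<subseteq> F"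
        using that(2) unfolding subset_chain_def by blast+
      then show ?thesis using chain_Union_filter[OF that(1)] that(1) by blast
    qed
  qed
  then obtain P where P: "sg_filter P" "c \<in> P" "d \<notin> P"
    and max: "\<And>F. sg_filter F \<Longrightarrow> c \<in> F \<Longrightarrow> d \<notin> F \<Longrightarrow> P \<subseteq> F \<Longrightarrow> F = P"
    by blast
  \<comment> \<open>By maximality, enlarging \<open>P\<close> by any outside element must capture
    \<open>d\<close>.\<close>
  have adj: "d \<in> adjoin P a" if "a \<in> carrier G" "a \<notin> P" for a
    using max[OF adjoin_filter[OF P(1) that(1)]] adjoin_superset[OF P(1)] adjoin_mem[OF P(1) that(1)]
      that(2) P(2) by blast
  have "a \<in> P \<or> b \<in> P"
    if a: "a \<in> carrier G" and b: "b \<in> carrier G" and ab: "compatible G a b" "ijoin a b \<in> P" for a b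
  proof (rule ccontr)
    assume "\<not> (a \<in> P \<or> b \<in> P)"
    then obtain p q where p: "p \<in> P" "\<forall>y\<in>carrier G. y \<preceq> p \<longrightarrow> y \<preceq> a \<longrightarrow> y \<preceq> d"
      and q: "q \<in> P" "\<forall>y\<in>carrier G. y \<preceq> q \<longrightarrow> y \<preceq> b \<longrightarrow> y \<preceq> d"
      using adj[OF a] adj[OF b] unfolding adjoin_def by blast
    obtain s where s: "s \<in> P" "s \<preceq> p" "s \<preceq> q" by (rule filter_directed[OF P(1) p(1) q(1)])
    obtain r where r: "r \<in> P" "r \<preceq> s" "r \<preceq> ijoin a b" by (rule filter_directed[OF P(1) s(1) ab(2)])
    have cl: "r \<in> carrier G" "s \<in> carrier G" "p \<in> carrier G" "q \<in> carrier G"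
      using filter_closed[OF P(1)] r s p q by blast+
    note j = ijoin_props[OF a b ab(1)]
    \<comment> \<open>Restricted to this idempotent, \<open>ijoin a b\<close> becomes
      \<open>r\<close>. Thus \<open>r\<close> splits into the pieces \<open>a \<otimes> ?e\<close>
      and \<open>b \<otimes> ?e\<close>, and each piece is below \<open>d\<close> by the choice of
      \<open>p\<close> and \<open>q\<close>.\<close>
    let ?e = "\<iota> r \<otimes> r"
    have re: "r = ijoin a b \<otimes> ?e" by (rule ile_restrict[OF r(3) j(1)])
    have e: "?e \<in> idems G" "?e \<in> carrier G" using cl by simp_all
    have le: "a \<otimes> ?e \<preceq> r" "b \<otimes> ?e \<preceq> r"
      using ile_mult_right[OF j(2) j(1) e(2)] ile_mult_right[OF j(3) j(1) e(2)] re by simp_all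
    have rp: "r \<preceq> p" "r \<preceq> q" using r s cl ile_trans by blast+
    have "a \<otimes> ?e \<preceq> p" "b \<otimes> ?e \<preceq> q" using le rp cl ile_trans by blast+
    moreover have "a \<otimes> ?e \<preceq> a" "b \<otimes> ?e \<preceq> b" using e(1) by (auto intro: ileI)
    ultimately have "a \<otimes> ?e \<preceq> d" "b \<otimes> ?e \<preceq> d" using p(2) q(2) a b e(2) by blast+
    then have "ijoin (a \<otimes> ?e) (b \<otimes> ?e) \<preceq> d"
      using ijoin_least compatible_mult_right[OF a b ab(1) e(2)] a b d e(2) by blast
    \<comment> \<open>Distributivity reassembles \<open>r\<close> as the join of the two
      pieces.\<close>
    then have "r \<preceq> d" using re distrib_right[OF a b e(2) ab(1)] by simp
    then show False using filter_up[OF P(1) r(1)] d P(3) by blast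
  qed
  moreover have "sg_zero G \<notin> P"
    using filter_up[OF P(1) _ zero_le[OF d] d] P(3) by blast
  ultimately have "prime_filter P" using P(1) unfolding prime_filter_def by blast
  then show thesis using that P by blast
qed

section \<open>The action on prime filters\<close>

text \<open>The set is the upward closure of the translate \<open>b P\<close>. Described as a
  preimage under multiplication by \<open>\<iota> b\<close>, it inherits primeness directly, since
  that multiplication preserves joins.\<close>

lemma translate_prime_filter:
  assumes P: "prime_filter P" and b: "b \<in> carrier G" and dom: "\<And>p. p \<in> P \<Longrightarrow> \<iota> b \<otimes> (b \<otimes> p) \<in> P"
  shows "prime_filter {x \<in> carrier G. \<iota> b \<otimes> x \<in> P}"
proof -
  let ?Q = "{x \<in> carrier G. \<iota> b \<otimes> x \<in> P}"
  note PD = prime_filterD[OF P]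
  note cl = filter_closed[OF PD(1)]
  have "sg_filter ?Q"
    unfolding sg_filter_def
  proof (intro conjI ballI impI)
    show "?Q \<noteq> {}" using filter_nonempty[OF PD(1)] dom cl b by blast
    show "y \<in> ?Q" if "x \<in> ?Q" "y \<in> carrier G" "x \<preceq> y" for x y
      using that filter_up[OF PD(1), of "\<iota> b \<otimes> x"] ile_mult_left[of x y "\<iota> b"] b by simp
    show "\<exists>z\<in>?Q. z \<preceq> x \<and> z \<preceq> y" if xy: "x \<in> ?Q" "y \<in> ?Q" for x y
    proof -
      from xy obtain r where r: "r \<in> P" "r \<preceq> \<iota> b \<otimes> x" "r \<preceq> \<iota> b \<otimes> y"
        using filter_directed[OF PD(1)] by (metis (no_types, lifting) mem_Collect_eq)
      \<comment> \<open>The translate \<open>b \<otimes> r\<close> is the common lower bound needed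
        for directedness.\<close>
      have "b \<otimes> r \<preceq> w" if w: "w \<in> carrier G" "r \<preceq> \<iota> b \<otimes> w" for w
      proof -
        have "b \<otimes> r \<preceq> b \<otimes> (\<iota> b \<otimes> w)" using w b by (intro ile_mult_left) simp_all
        moreover have "b \<otimes> (\<iota> b \<otimes> w) \<preceq> w" using idem_mult_le[of "b \<otimes> \<iota> b" w] w b by simp
        ultimately show ?thesis using ile_trans w(1) by blast
      qed
      moreover have "b \<otimes> r \<in> ?Q" using dom[OF r(1)] cl[OF r(1)] b by simp
      ultimately show ?thesis using xy r by blast
    qed
  qed auto
  moreover have "sg_zero G \<notin> ?Q" using PD(2) b by simp
  moreover have "x \<in> ?Q \<or> y \<in> ?Q"
    if "x \<in> carrier G" "y \<in> carrier G" "compatible G x y" "ijoin x y \<in> ?Q" for x y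
    using that PD(3)[of "\<iota> b \<otimes> x" "\<iota> b \<otimes> y"] distrib_left[of x y "\<iota> b"]
      compatible_mult_left[of x y "\<iota> b"] b by auto
  ultimately show ?thesis unfolding prime_filter_def by blast
qed

definition act :: "'a \<Rightarrow> ('a set \<times> 'a set) set" where
  "act a = {(P, Q). prime_filter P \<and> prime_filter Q
     \<and> (\<forall>p\<in>P. a \<otimes> p \<in> Q) \<and> (\<forall>q\<in>Q. \<iota> a \<otimes> q \<in> P)}"

lemma act_inv: "a \<in> carrier G \<Longrightarrow> act (\<iota> a) = (act a)\<inverse>"
  by (auto simp: act_def)

text \<open>Going back along \<open>Q\<close> and forward along \<open>Q'\<close> sends
  \<open>q\<close> to \<open>a \<otimes> (\<iota> a \<otimes> q)\<close>, an element of
  \<open>Q'\<close> below \<open>q\<close>. So \<open>Q\<close> is contained in \<open>Q'\<close>,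
  and the roles can be exchanged.\<close>

lemma act_single_valued:
  assumes a: "a \<in> carrier G"
  shows "single_valued (act a)"
proof -
  have "Q \<subseteq> Q'" if "(P, Q) \<in> act a" "(P, Q') \<in> act a" for P Q Q'
  proof
    fix q assume q: "q \<in> Q"
    have Q: "sg_filter Q" "sg_filter Q'" using that by (auto simp: act_def prime_filter_def)
    have "a \<otimes> (\<iota> a \<otimes> q) \<in> Q'" using that q by (auto simp: act_def)
    moreover have "a \<otimes> (\<iota> a \<otimes> q) \<preceq> q"
      using idem_mult_le[of "a \<otimes> \<iota> a" q] a filter_closed[OF Q(1) q] by simp
    ultimately show "q \<in> Q'" using filter_up[OF Q(2)] filter_closed[OF Q(1) q] by blast
  qed
  then show ?thesis unfolding single_valued_def by blast
qed

text \<open>Injectivity is single-valuedness for \<open>\<iota> a\<close>, because inversion turns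
  the action into its converse.\<close>

lemma act_partial_bijection:
  assumes "a \<in> carrier G"
  shows "act a \<in> partial_bijections (Collect prime_filter)"
  using act_single_valued[OF assms] act_single_valued[of "\<iota> a"] act_inv[OF assms] assms
  by (auto simp: partial_bijections_def act_def)

section \<open>The action respects the operations\<close>

lemma act_zero: "act (sg_zero G) = {}"
proof -
  have False if PQ: "(P, Q) \<in> act (sg_zero G)" for P Q
  proof -
    have P: "sg_filter P" and Q: "sg_zero G \<notin> Q" using PQ by (auto simp: act_def prime_filter_def)
    obtain p where "p \<in> P" using filter_nonempty[OF P] by blast
    moreover from this have "sg_zero G \<otimes> p \<in> Q" using PQ by (auto simp: act_def)
    ultimately show False using filter_closed[OF P] Q by simp
  qed
  then show ?thesis by auto
qed

lemma act_one: "act \<one> = Id_on (Collect prime_filter)"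
proof -
  have "(\<forall>p\<in>P. \<one> \<otimes> p \<in> Q) \<longleftrightarrow> P \<subseteq> Q" if "prime_filter P" for P Q
    using filter_closed[OF prime_filter_filter[OF that]] by auto
  then show ?thesis by (auto simp: act_def sg_inv_one)
qed

lemma act_mult:
  assumes a: "a \<in> carrier G" and b: "b \<in> carrier G"
  shows "act (a \<otimes> b) = act b O act a"
proof
  show "act b O act a \<subseteq> act (a \<otimes> b)"
  proof (rule subrelI)
    fix P R assume "(P, R) \<in> act b O act a"
    then obtain Q where Q: "(P, Q) \<in> act b" "(Q, R) \<in> act a" by blast
    then have P: "prime_filter P" and R: "prime_filter R" by (simp_all add: act_def)
    show "(P, R) \<in> act (a \<otimes> b)"
      using Q filter_closed[OF prime_filter_filter[OF P]] filter_closed[OF prime_filter_filter[OF R]] a b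
      by (auto simp: act_def inv_mult)
  qed
  show "act (a \<otimes> b) \<subseteq> act b O act a"
  proof (rule subrelI)
    fix P R assume PR: "(P, R) \<in> act (a \<otimes> b)"
    then have PR': "prime_filter P" "prime_filter R" by (simp_all add: act_def)
    note P = prime_filter_filter[OF PR'(1)] and R = prime_filter_filter[OF PR'(2)]
    have abp: "a \<otimes> (b \<otimes> p) \<in> R" if "p \<in> P" for p
      using PR that a b filter_closed[OF P] by (auto simp: act_def)
    have bar: "\<iota> b \<otimes> (\<iota> a \<otimes> r) \<in> P" if "r \<in> R" for r
      using PR that a b filter_closed[OF R] by (auto simp: act_def inv_mult)
    have le: "x \<otimes> (\<iota> a \<otimes> (a \<otimes> y)) \<preceq> x \<otimes> y" if "x \<in> carrier G" "y \<in> carrier G" for x y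
      using ile_mult_left[OF idem_mult_le[of "\<iota> a \<otimes> a" y]] a that by simp
    \<comment> \<open>Moving \<open>p\<close> to \<open>R\<close> by \<open>a \<otimes> b\<close>
      and back gives an element of \<open>P\<close>; dropping the inner idempotent
      \<open>\<iota> a \<otimes> a\<close> only enlarges it.\<close>
    have dom: "\<iota> b \<otimes> (b \<otimes> p) \<in> P" if p: "p \<in> P" for p
      using filter_up[OF P bar[OF abp[OF p]] le] filter_closed[OF P p] b by simp
    \<comment> \<open>The intermediate filter must be the image of \<open>P\<close> under
      \<open>b\<close>, that is, the upward closure of \<open>b P\<close>.\<close>
    define Q where "Q = {x \<in> carrier G. \<iota> b \<otimes> x \<in> P}"
    have Q: "prime_filter Q" unfolding Q_def by (rule translate_prime_filter[OF PR'(1) b dom])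
    have "(P, Q) \<in> act b"
      using PR'(1) Q dom b filter_closed[OF P] by (auto simp: act_def Q_def)
    moreover have "a \<otimes> x \<in> R" if x: "x \<in> Q" for x
    proof -
      have x': "x \<in> carrier G" "\<iota> b \<otimes> x \<in> P" using x by (simp_all add: Q_def)
      have "a \<otimes> (b \<otimes> (\<iota> b \<otimes> x)) \<preceq> a \<otimes> x"
        using ile_mult_left[OF idem_mult_le[of "b \<otimes> \<iota> b" x]] a b x' by simp
      then show ?thesis using filter_up[OF R abp[OF x'(2)]] a x' by simp
    qed
    then have "(Q, R) \<in> act a"
      using PR'(2) Q bar a filter_closed[OF R] by (auto simp: act_def Q_def)
    ultimately show "(P, R) \<in> act b O act a" by blast
  qed
qed

lemma act_mono:
  assumes "c \<preceq> a" "c \<in> carrier G" "a \<in> carrier G"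
  shows "act c \<subseteq> act a"
proof (rule subrelI)
  fix P Q assume PQ: "(P, Q) \<in> act c"
  then have P: "sg_filter P" and Q: "sg_filter Q" by (simp_all add: act_def prime_filter_def)
  have "a \<otimes> p \<in> Q" if p: "p \<in> P" for p
    using filter_up[OF Q _ ile_mult_right[OF assms(1)]] PQ p filter_closed[OF P p] assms
    by (auto simp: act_def)
  moreover have "\<iota> a \<otimes> q \<in> P" if q: "q \<in> Q" for q
    using filter_up[OF P _ ile_mult_right[OF ile_inv[OF assms(1)]]] PQ q filter_closed[OF Q q] assms
    by (auto simp: act_def)
  ultimately show "(P, Q) \<in> act a" using PQ by (auto simp: act_def)
qed

text \<open>Below \<open>a\<close>, the forward condition alone suffices: as
  \<open>\<iota> c\<close> equals \<open>\<iota> a \<otimes> (c \<otimes> \<iota> a)\<close>, the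
  backward condition follows by travelling from \<open>Q\<close> to \<open>P\<close> to
  \<open>Q\<close> to \<open>P\<close>.\<close>

lemma act_restrict:
  assumes "c \<preceq> a" "c \<in> carrier G" "a \<in> carrier G" and PQ: "(P, Q) \<in> act a"
    and cP: "\<And>p. p \<in> P \<Longrightarrow> c \<otimes> p \<in> Q"
  shows "(P, Q) \<in> act c"
proof -
  have "\<iota> c \<otimes> q \<in> P" if q: "q \<in> Q" for q
  proof -
    have "q \<in> carrier G" using PQ q filter_closed by (auto simp: act_def prime_filter_def)
    then have "\<iota> a \<otimes> (c \<otimes> (\<iota> a \<otimes> q)) = \<iota> c \<otimes> q"
      using arg_cong[OF ile_sandwich[OF assms(1,3)], of "\<lambda>x. x \<otimes> q"] assms(2,3) by simp
    moreover have "\<iota> a \<otimes> (c \<otimes> (\<iota> a \<otimes> q)) \<in> P"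
      using PQ q cP by (auto simp: act_def)
    ultimately show ?thesis by simp
  qed
  then show ?thesis using PQ cP by (auto simp: act_def)
qed

text \<open>Right multiplication by \<open>p\<close> is undone by \<open>\<iota> p\<close>: the
  element \<open>r \<otimes> \<iota> p\<close> is below \<open>a\<close> and \<open>b\<close>, hence
  below their meet, and multiplying by \<open>p\<close> returns \<open>r\<close>.\<close>

lemma le_imeet_mult:
  assumes a: "a \<in> carrier G" and b: "b \<in> carrier G" and p: "p \<in> carrier G" and r: "r \<in> carrier G"
    and ra: "r \<preceq> a \<otimes> p" and rb: "r \<preceq> b \<otimes> p"
  shows "r \<preceq> imeet a b \<otimes> p"
proof -
  let ?e = "\<iota> r \<otimes> r"
  have e: "?e \<in> idems G" "?e \<in> carrier G" using r by simp_all
  have le: "r \<otimes> \<iota> p \<preceq> x" if x: "x \<in> carrier G" "r \<preceq> x \<otimes> p" for x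
  proof (rule ileI)
    show "p \<otimes> (?e \<otimes> \<iota> p) \<in> idems G" by (rule idem_conj[OF p e(1)])
    show "r \<otimes> \<iota> p = x \<otimes> (p \<otimes> (?e \<otimes> \<iota> p))"
      using arg_cong[OF ile_restrict[OF x(2)], of "\<lambda>z. z \<otimes> \<iota> p"] x p r by simp
  qed
  have "r \<otimes> \<iota> p \<preceq> imeet a b"
    using imeet_greatest[OF a b _ le[OF a ra] le[OF b rb]] p r by simp
  then have "(r \<otimes> \<iota> p) \<otimes> p \<preceq> imeet a b \<otimes> p"
    using ile_mult_right imeet_closed[OF a b] p by blast
  \<comment> \<open>As \<open>r\<close> is \<open>a \<otimes> p \<otimes> f\<close>, the idempotent
    \<open>\<iota> p \<otimes> p\<close> commutes past \<open>f\<close> and is absorbed by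
    \<open>p\<close>.\<close>
  moreover have "(r \<otimes> \<iota> p) \<otimes> p = r"
  proof -
    from ra obtain f where f: "f \<in> idems G" "r = a \<otimes> p \<otimes> f" by (rule ileE)
    then show ?thesis using a p by (simp add: inv_mult_idem_commute[OF p f(1), symmetric])
  qed
  ultimately show ?thesis by simp
qed

lemma act_meet:
  assumes a: "a \<in> carrier G" and b: "b \<in> carrier G"
  shows "act (imeet a b) = act a \<inter> act b"
proof
  note m = imeet_props[OF a b]
  show "act (imeet a b) \<subseteq> act a \<inter> act b"
    using act_mono[OF m(2) m(1) a] act_mono[OF m(3) m(1) b] by blast
  show "act a \<inter> act b \<subseteq> act (imeet a b)"
  proof (rule subrelI)
    fix P Q assume PQ: "(P, Q) \<in> act a \<inter> act b"
    then have P: "sg_filter P" and Q: "sg_filter Q" by (simp_all add: act_def prime_filter_def)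
    have "imeet a b \<otimes> p \<in> Q" if p: "p \<in> P" for p
    proof -
      have "a \<otimes> p \<in> Q" "b \<otimes> p \<in> Q" using PQ p by (auto simp: act_def)
      \<comment> \<open>Directedness of \<open>Q\<close> replaces the two memberships by one
        element, which lies below \<open>imeet a b \<otimes> p\<close>.\<close>
      then obtain r where r: "r \<in> Q" "r \<preceq> a \<otimes> p" "r \<preceq> b \<otimes> p" by (rule filter_directed[OF Q])
      have "p \<in> carrier G" "r \<in> carrier G" using filter_closed P Q p r by blast+
      then show ?thesis using filter_up[OF Q r(1) le_imeet_mult] a b r m(1) by simp
    qed
    then show "(P, Q) \<in> act (imeet a b)" using act_restrict[OF m(2) m(1) a] PQ by blast
  qed
qed

lemma act_join:
  assumes a: "a \<in> carrier G" and b: "b \<in> carrier G" and ab: "compatible G a b"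
  shows "act (ijoin a b) = act a \<union> act b"
proof
  note j = ijoin_props[OF a b ab]
  show "act a \<union> act b \<subseteq> act (ijoin a b)"
    using act_mono[OF j(2) a j(1)] act_mono[OF j(3) b j(1)] by blast
  show "act (ijoin a b) \<subseteq> act a \<union> act b"
  proof (rule subrelI, rule ccontr)
    fix P Q assume PQ: "(P, Q) \<in> act (ijoin a b)" and "(P, Q) \<notin> act a \<union> act b"
    then obtain p q where p: "p \<in> P" "a \<otimes> p \<notin> Q" and q: "q \<in> P" "b \<otimes> q \<notin> Q"
      using act_restrict[OF j(2) a j(1) PQ] act_restrict[OF j(3) b j(1) PQ] by blast
    have P: "sg_filter P" and Q: "prime_filter Q" using PQ by (simp_all add: act_def prime_filter_def)
    \<comment> \<open>The failures for \<open>a\<close> and \<open>b\<close> occur at different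
      elements of \<open>P\<close>. Both persist at a common lower bound \<open>r\<close>, where
      primeness of \<open>Q\<close> rules them out together.\<close>
    obtain r where r: "r \<in> P" "r \<preceq> p" "r \<preceq> q" by (rule filter_directed[OF P p(1) q(1)])
    have cl: "r \<in> carrier G" "p \<in> carrier G" "q \<in> carrier G"
      using filter_closed[OF P] p q r by blast+
    have "ijoin a b \<otimes> r \<in> Q" using PQ r(1) by (auto simp: act_def)
    then have "a \<otimes> r \<in> Q \<or> b \<otimes> r \<in> Q"
      using prime_filter_prime[OF Q, of "a \<otimes> r" "b \<otimes> r"] distrib_right[OF a b cl(1) ab]
        compatible_mult_right[OF a b ab cl(1)] a b cl by simp
    then show False
      using filter_up[OF prime_filter_filter[OF Q]] ile_mult_left[OF r(2) cl(2) a]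
        ile_mult_left[OF r(3) cl(3) b] p(2) q(2) a b cl mult_closed by blast
  qed
qed

section \<open>Faithfulness of the action and transfer of inequalities\<close>

lemma le_if_act_subset:
  assumes c: "c \<in> carrier G" and d: "d \<in> carrier G" and sub: "act c \<subseteq> act d"
  shows "c \<preceq> d"
proof (rule ccontr)
  assume "\<not> c \<preceq> d"
  then obtain P where P: "prime_filter P" "c \<in> P" "d \<notin> P" by (rule prime_filter_exists[OF c d])
  note F = prime_filter_filter[OF P(1)]
  \<comment> \<open>An element \<open>r\<close> of \<open>P\<close> below \<open>c\<close> is fixed
    by \<open>c \<otimes> \<iota> c\<close>, so it stays below the translate of
    \<open>p\<close>.\<close>
  have ran: "c \<otimes> (\<iota> c \<otimes> p) \<in> P" if p: "p \<in> P" for p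
  proof -
    obtain r where r: "r \<in> P" "r \<preceq> p" "r \<preceq> c" by (rule filter_directed[OF F p P(2)])
    have "p \<in> carrier G" using filter_closed[OF F p] .
    then have "c \<otimes> (\<iota> c \<otimes> r) \<preceq> c \<otimes> (\<iota> c \<otimes> p)"
      using r c by (intro ile_mult_left) simp_all
    then show ?thesis using filter_up[OF F r(1)] mult_inv_le[OF r(3) c] c \<open>p \<in> carrier G\<close> by simp
  qed
  \<comment> \<open>This is the translate of \<open>P\<close> by \<open>\<iota> c\<close>, so
    \<open>c\<close> carries it to \<open>P\<close>.\<close>
  define P0 where "P0 = {x \<in> carrier G. c \<otimes> x \<in> P}"
  have "prime_filter P0"
    using translate_prime_filter[OF P(1), of "\<iota> c"] ran c by (simp add: P0_def)
  then have "(P0, P) \<in> act c"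
    using P(1) ran filter_closed[OF F] c by (auto simp: act_def P0_def)
  then have "(P0, P) \<in> act d" using sub by blast
  \<comment> \<open>The domain idempotent of \<open>c\<close> is the test element: if
    \<open>d\<close> also carried \<open>P0\<close> to \<open>P\<close>, then a restriction of
    \<open>d\<close>, and hence \<open>d\<close>, would lie in \<open>P\<close>.\<close>
  moreover have "\<iota> c \<otimes> c \<in> P0" using P(2) c by (simp add: P0_def)
  ultimately have "d \<otimes> (\<iota> c \<otimes> c) \<in> P" by (auto simp: act_def)
  moreover have "d \<otimes> (\<iota> c \<otimes> c) \<preceq> d" using c by (auto intro: ileI[of "\<iota> c \<otimes> c"])
  ultimately show False using filter_up[OF F] d P(3) by blast
qed

text \<open>By induction on the term. Definedness carries over along with the value: for a
  compatible pair the union of the two actions is the action of the join, hence a partial bijection,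
  so the images are compatible.\<close>

lemma value_at_act:
  assumes "\<And>i. i \<in> vars t \<Longrightarrow> v i \<in> carrier G" "value_at G v t = Some c"
  shows "c \<in> carrier G \<and>
    value_at (sym_inv (Collect prime_filter)) (\<lambda>i. act (v i)) t = Some (act c)"
  using assms
proof (induction t arbitrary: c)
  case Zero
  then show ?case by (auto simp: act_zero sym_inv_zero)
next
  case One
  then show ?case by (auto simp: act_one)
next
  case (Mult s t)
  then show ?case by (fastforce simp: bind_eq_Some_conv act_mult)
next
  case (Meet s t)
  from Meet.prems(2) obtain a b where "value_at G v s = Some a" "value_at G v t = Some b"
    "c = imeet a b" by (auto simp: bind_eq_Some_conv)
  then show ?case
    using Meet.IH(1)[of a] Meet.IH(2)[of b] Meet.prems(1)
    by (auto simp: imeet_closed act_meet sym_inv_meet[OF act_partial_bijection act_partial_bijection])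
next
  case (Join s t)
  from Join.prems(2) obtain a b where ab: "value_at G v s = Some a" "value_at G v t = Some b"
    "compatible G a b" "c = ijoin a b" by (auto simp: bind_eq_Some_conv split: if_splits)
  have IH: "a \<in> carrier G" "b \<in> carrier G"
    "value_at (sym_inv (Collect prime_filter)) (\<lambda>i. act (v i)) s = Some (act a)"
    "value_at (sym_inv (Collect prime_filter)) (\<lambda>i. act (v i)) t = Some (act b)"
    using Join.IH(1)[OF _ ab(1)] Join.IH(2)[OF _ ab(2)] Join.prems(1) by auto
  note pb = act_partial_bijection[OF IH(1)] act_partial_bijection[OF IH(2)]
  have un: "act a \<union> act b \<in> partial_bijections (Collect prime_filter)"
    using act_partial_bijection[OF ijoin_closed] act_join IH(1,2) ab(3) by metis
  then show ?case
    using IH ab ijoin_closed by (simp add: act_join sym_inv_join[OF pb] sym_inv_compatible[OF pb])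
next
  case (Inv t)
  from Inv.prems(2) obtain a where "value_at G v t = Some a" "c = \<iota> a"
    by (auto simp: bind_eq_Some_conv)
  then show ?case
    using Inv.IH[of a] Inv.prems(1) by (auto simp: act_inv sym_inv_inv[OF act_partial_bijection])
qed auto

lemma satisfies_le_if_sym_inv:
  assumes vars: "vars \<phi> \<subseteq> {1..n}" "vars \<psi> \<subseteq> {1..n}"
    and le: "satisfies_le (sym_inv (Collect prime_filter)) n \<phi> \<psi>"
  shows "satisfies_le G n \<phi> \<psi>"
  unfolding satisfies_le_def
proof (intro ballI allI impI)
  fix v a b
  assume v: "v \<in> {1..n} \<rightarrow> carrier G" and ab: "value_at G v \<phi> = Some a" "value_at G v \<psi> = Some b"
  have a: "a \<in> carrier G" "value_at (sym_inv (Collect prime_filter)) (\<lambda>i. act (v i)) \<phi> = Some (act a)"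
    and b: "b \<in> carrier G" "value_at (sym_inv (Collect prime_filter)) (\<lambda>i. act (v i)) \<psi> = Some (act b)"
    using value_at_act[OF _ ab(1)] value_at_act[OF _ ab(2)] v vars by blast+
  \<comment> \<open>The hypothesis is applied to the valuation transported by \<open>act\<close>;
    faithfulness then pulls the inclusion back to \<open>G\<close>.\<close>
  have "(\<lambda>i. act (v i)) \<in> {1..n} \<rightarrow> carrier (sym_inv (Collect prime_filter))"
    using v act_partial_bijection by auto
  then have "act a \<sqsubseteq>\<^bsub>nat_order (sym_inv (Collect prime_filter))\<^esub> act b"
    using le a(2) b(2) unfolding satisfies_le_def by blast
  then have "act a \<subseteq> act b"
    using sym_inv_le[OF act_partial_bijection[OF a(1)] act_partial_bijection[OF b(1)]] by simp
  then show "a \<preceq> b" by (rule le_if_act_subset[OF a(1) b(1)])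
qed

end

theorem theorem3p25:
  fixes \<phi> \<psi> :: dis_term and n :: nat
  assumes "vars \<phi> \<subseteq> {1..n}" and "vars \<psi> \<subseteq> {1..n}"
    and "\<forall>X :: 'a set set. satisfies_le (sym_inv X) n \<phi> \<psi>"
  shows "\<forall>A :: ('a, 'm) monoid_scheme. distributive_inverse_semigroup A \<longrightarrow> satisfies_le A n \<phi> \<psi>"
  \<comment> \<open>The set \<open>X\<close> is instantiated with the prime filters of
    \<open>A\<close>, which are points of type \<open>'a set\<close>.\<close>
  using distributive_inverse_semigroup.satisfies_le_if_sym_inv[OF _ assms(1,2)] assms(3) by blast

end
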